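(* Let $G$ be a finite group of order $m$ with identity $e$, let $S\subseteq G\setminus\{e\}$ and $T=(G\setminus\{e\})\setminus S$, and let $n=m+1$. Then there exists a $k$ such that $S$ is a quasi-signature set for an $(n,k)$-equiangular frame if and only if the following hold: (a) $g\in S$ implies $g^{-1}\in S$, and $h\in T$ implies $h^{-1}\in T$; (b) for all $g\in S$, $$N_{(S,S)}^g-2N_{(S,T)}^g+N_{(T,T)}^g=\mu-1,$$ and for all $h\in T$, $$N_{(S,S)}^h-2N_{(S,T)}^h+N_{(T,T)}^h=-\mu-1,$$ where $\mu=|S|-|T|$. In this case $k$ is related to $\mu$ by $$\mu=(n-2k)\sqrt{\frac{n-1}{k(n-k)}},\qquad k=\frac n2-\frac{\mu n}{2\sqrt{4(n-1)+\mu^2}}.$$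
   Context: For subsets $A,B\subseteq G$ and $g\in G$, $N_{(A,B)}^g=\#\{(g_1,g_2)\in A\times B: g_1g_2=g\}$. An $(n,k)$-frame is a Parseval frame $\{f_1,\dots,f_n\}$ for $\mathbb C^k$, i.e. $\sum_{j}|\langle x,f_j\rangle|^2=\|x\|^2$ for all $x\in\mathbb C^k$. It is equiangular if all $f_i\neq 0$ and there is a constant $b$ with $|\langle f_i/\|f_i\|,f_j/\|f_j\|\rangle|=b$ for all $i\ne j$. For $1\le k<n$, put $c_{n,k}=\sqrt{\frac{k(n-k)}{n^2(n-1)}}$. A self-adjoint $n\times n$ matrix $Q$ with $Q_{ii}=0$ and $|Q_{ij}|=1$ for $i\neq j$ is the signature matrix of an $(n,k)$-equiangular frame if there is an equiangular $(n,k)$-frame whose Gram matrix $(\langle f_j,f_i\rangle)_{i,j}$ equals $\frac kn I_n+c_{n,k}Q$. Throughout $1\le k<n$. Let $\lambda$ be the left regular representation of $G$: $\lambda(g)e_h=e_{gh}$ on the vector space with basis $\{e_h\}_{h\in G}$, regarded as $m\times m$ permutation matrices. For $S\subseteq G\setminus\{e\}$ and $T=(G\setminus\{e\})\setminus S$, let $Q=\sum_{g\in S}\lambda(g)-\sum_{h\in T}\lambda(h)$ and let $\tilde Q=\begin{bmatrix}0&C^t\\ C&Q\end{bmatrix}$, where $C\in\mathbb C^m$ is the all-ones column vector. With $n=m+1$, $S$ is a quasi-signature set for an $(n,k)$-equiangular frame if the $n\times n$ matrix $\tilde Q$ is the signature matrix of an $(n,k)$-equiangular frame. *)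

theory Defs
  imports
    Complex_Main
    "HOL-Algebra.Coset"
    "Jordan_Normal_Form.Matrix"
    "Jordan_Normal_Form.Schur_Decomposition"
begin

(* Vectors of C^k are the elements of carrier_vec k :: complex vec set, and v \<bullet>c w is the
   inner product, linear in v and conjugate linear in w. Index sets {1,...,n} become {..<n}. *)

definition cvec_norm :: "complex vec \<Rightarrow> real" where
  "cvec_norm x = sqrt (Re (x \<bullet>c x))"

(* The values f i with i >= n are irrelevant. *)
definition parseval_frame :: "nat \<Rightarrow> nat \<Rightarrow> (nat \<Rightarrow> complex vec) \<Rightarrow> bool" where
  "parseval_frame n k f \<longleftrightarrow>
     (\<forall>j<n. f j \<in> carrier_vec k) \<and>
     (\<forall>x\<in>carrier_vec k. (\<Sum>j<n. (cmod (x \<bullet>c f j))\<^sup>2) = (cvec_norm x)\<^sup>2)"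

definition normalized :: "complex vec \<Rightarrow> complex vec" where
  "normalized x = complex_of_real (1 / cvec_norm x) \<cdot>\<^sub>v x"

definition equiangular_frame :: "nat \<Rightarrow> nat \<Rightarrow> (nat \<Rightarrow> complex vec) \<Rightarrow> bool" where
  "equiangular_frame n k f \<longleftrightarrow>
     parseval_frame n k f \<and>
     (\<forall>i<n. f i \<noteq> 0\<^sub>v k) \<and>
     (\<exists>b::real. \<forall>i<n. \<forall>j<n. i \<noteq> j \<longrightarrow> cmod (normalized (f i) \<bullet>c normalized (f j)) = b)"

definition gram_matrix :: "nat \<Rightarrow> (nat \<Rightarrow> complex vec) \<Rightarrow> complex mat" where
  "gram_matrix n f = mat n n (\<lambda>(i, j). f j \<bullet>c f i)"

definition frame_const :: "nat \<Rightarrow> nat \<Rightarrow> real" where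
  "frame_const n k = sqrt (real k * (real n - real k) / ((real n)\<^sup>2 * (real n - 1)))"

definition signature_matrix :: "nat \<Rightarrow> nat \<Rightarrow> complex mat \<Rightarrow> bool" where
  "signature_matrix n k Q \<longleftrightarrow>
     1 \<le> k \<and> k < n \<and>
     Q \<in> carrier_mat n n \<and> mat_adjoint Q = Q \<and>
     (\<forall>i<n. Q $$ (i, i) = 0) \<and>
     (\<forall>i<n. \<forall>j<n. i \<noteq> j \<longrightarrow> cmod (Q $$ (i, j)) = 1) \<and>
     (\<exists>f. equiangular_frame n k f \<and>
        gram_matrix n f =
          complex_of_real (real k / real n) \<cdot>\<^sub>m 1\<^sub>m n +
          complex_of_real (frame_const n k) \<cdot>\<^sub>m Q)"

definition num_factorizations :: "('a, 'b) monoid_scheme \<Rightarrow> 'a set \<Rightarrow> 'a set \<Rightarrow> 'a \<Rightarrow> nat" where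
  "num_factorizations G A B g = card {(g1, g2) \<in> A \<times> B. g1 \<otimes>\<^bsub>G\<^esub> g2 = g}"

(* An enumeration e of carrier G by {..<order G} turns operators on the space with basis
   (e_h), h in G, into matrices: position i stands for the basis vector e_(e i). So column j
   of the matrix below has its single 1 in the row of the element g * e j. *)
definition left_regular ::
    "('a, 'b) monoid_scheme \<Rightarrow> (nat \<Rightarrow> 'a) \<Rightarrow> 'a \<Rightarrow> complex mat" where
  "left_regular G e g =
     mat (Coset.order G) (Coset.order G) (\<lambda>(i, j). if e i = g \<otimes>\<^bsub>G\<^esub> e j then 1 else 0)"

definition signed_sum_matrix ::
    "('a, 'b) monoid_scheme \<Rightarrow> (nat \<Rightarrow> 'a) \<Rightarrow> 'a set \<Rightarrow> 'a set \<Rightarrow> complex mat" where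
  "signed_sum_matrix G e S T =
     (let M = module_mat TYPE(complex) (Coset.order G) (Coset.order G)
      in finsum M (left_regular G e) S - finsum M (left_regular G e) T)"

definition bordered_matrix :: "nat \<Rightarrow> complex mat \<Rightarrow> complex mat" where
  "bordered_matrix m Q =
     (let C = mat m 1 (\<lambda>_. 1) in four_block_mat (0\<^sub>m 1 1) (transpose_mat C) C Q)"

definition quasi_signature_set ::
    "('a, 'b) monoid_scheme \<Rightarrow> (nat \<Rightarrow> 'a) \<Rightarrow> nat \<Rightarrow> nat \<Rightarrow> 'a set \<Rightarrow> bool" where
  "quasi_signature_set G e n k S \<longleftrightarrow>
     S \<subseteq> carrier G - {\<one>\<^bsub>G\<^esub>} \<and> n = Coset.order G + 1 \<and>
     signature_matrix n k
       (bordered_matrix (Coset.order G)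
         (signed_sum_matrix G e S ((carrier G - {\<one>\<^bsub>G\<^esub>}) - S)))"

end

theory Submission
  imports Defs
begin

text \<open>
  An equiangular frame is an orthogonal projection in disguise. The Parseval identity says that the
  Gram matrix \<open>P\<close> of an \<open>(n,k)\<close>-frame is a self-adjoint idempotent, and conversely every self-adjoint
  idempotent \<open>P\<close> factors as \<open>V V\<^sup>*\<close> with \<open>V\<^sup>* V = I\<close> on \<open>k = trace P\<close> dimensions, so that the conjugated rows of
  \<open>V\<close> form a Parseval frame with Gram matrix \<open>P\<close>. Writing \<open>P = (k/n) I + c Q\<close>, idempotence of \<open>P\<close> becomes
  \<open>Q\<^sup>2 = (n - 1) I + \<nu> Q\<close> with \<open>\<nu> = (n - 2 k) sqrt ((n - 1) / (k (n - k)))\<close>. Hence a self-adjoint matrix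
  with zero diagonal and unimodular entries elsewhere is a signature matrix for some \<open>k\<close> exactly when
  it satisfies such a quadratic equation for some real \<open>\<nu>\<close>
  (\<open>signature_matrix_satisfies_quadratic\<close>, \<open>satisfies_quadratic_imp_signature_matrix\<close>). That \<open>k\<close> is an
  integer is automatic, since it is the trace of an idempotent.

  For the bordered matrix of \<open>Q = \<Sum>g\<in>S. \<lambda>(g) - \<Sum>h\<in>T. \<lambda>(h)\<close>, let \<open>\<chi> = 1\<^sub>S - 1\<^sub>T\<close>, so that the entry of \<open>Q\<close> at
  \<open>(x, y)\<close> is \<open>\<chi> (x y\<^sup>-\<^sup>1)\<close>. Self-adjointness says \<open>\<chi> (x\<^sup>-\<^sup>1) = \<chi> x\<close>, which is closure of \<open>S\<close> and \<open>T\<close> under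
  inverses. In the square of the bordered matrix, the border contributes the sum \<open>\<mu>\<close> of a row of \<open>Q\<close>, which
  forces \<open>\<nu> = \<mu>\<close>, and the inner block contributes \<open>1 + (\<chi> * \<chi>) (x y\<^sup>-\<^sup>1)\<close>. The convolution
  \<open>\<chi> * \<chi>\<close> at \<open>x\<close> equals \<open>N\<^sub>S\<^sub>S - N\<^sub>S\<^sub>T - N\<^sub>T\<^sub>S + N\<^sub>T\<^sub>T\<close>, and \<open>N\<^sub>S\<^sub>T = N\<^sub>T\<^sub>S\<close> because \<open>S\<close> and \<open>T\<close>
  complement each other in \<open>G\<close> without its identity (\<open>num_factorizations_commute\<close>). So the quadratic
  equation at \<open>x\<close> in \<open>S\<close> and in \<open>T\<close> is the counting condition, and at the identity it holds as soon as
  \<open>\<chi>\<close> is symmetric (\<open>bordered_satisfies_quadratic_iff\<close>, \<open>signed_count_conditions_iff\<close>). The formula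
  for \<open>\<mu>\<close> is \<open>\<nu> = \<mu>\<close>, and the formula for \<open>k\<close> solves it for \<open>k\<close>.
\<close>

section \<open>Orthogonal projections as Gram matrices\<close>

definition orthogonal_projection :: "nat \<Rightarrow> (nat \<Rightarrow> nat \<Rightarrow> complex) \<Rightarrow> bool" where
  "orthogonal_projection n P \<longleftrightarrow>
     (\<forall>i<n. \<forall>j<n. P j i = cnj (P i j)) \<and>
     (\<forall>i<n. \<forall>j<n. (\<Sum>l<n. P i l * P l j) = P i j)"

lemma cmod_square_of_real: "(complex_of_real (cmod z))\<^sup>2 = z * cnj z"
  using complex_norm_square[of z] by simp

text \<open>
  Since \<open>P = P P\<^sup>*\<close>, a diagonal entry is the squared norm of its row. In particular it is nonnegative,
  and it vanishes only together with the whole row.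
\<close>

lemma orthogonal_projection_diagonal:
  assumes P: "orthogonal_projection n P" and i: "i < n"
  shows "P i i = complex_of_real (\<Sum>l<n. (cmod (P i l))\<^sup>2)"
proof -
  have "P i i = (\<Sum>l<n. P i l * P l i)" using P i unfolding orthogonal_projection_def by metis
  also have "\<dots> = (\<Sum>l<n. P i l * cnj (P i l))"
    using P i unfolding orthogonal_projection_def by (intro sum.cong refl) (metis lessThan_iff)
  also have "\<dots> = complex_of_real (\<Sum>l<n. (cmod (P i l))\<^sup>2)"
    by (simp add: cmod_square_of_real)
  finally show ?thesis .
qed

text \<open>
  The vectors \<open>v 0, \<dots>, v (k - 1)\<close> form an orthonormal basis of the range of \<open>P\<close>. They are split off one
  at a time: a column of \<open>P\<close> with nonzero diagonal entry, normalized to \<open>w\<close>, is a unit vector of the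
  range, and \<open>P - w w\<^sup>*\<close> is again an orthogonal projection, with trace smaller by one. As the trace is
  never negative, this stops.
\<close>

lemma orthogonal_projection_factorization:
  fixes P :: "nat \<Rightarrow> nat \<Rightarrow> complex"
  assumes "orthogonal_projection n P"
  shows "\<exists>k (v :: nat \<Rightarrow> nat \<Rightarrow> complex).
      (\<forall>i<n. \<forall>j<n. P i j = (\<Sum>a<k. v a i * cnj (v a j))) \<and>
      (\<forall>a<k. \<forall>b<k. (\<Sum>i<n. v a i * cnj (v b i)) = (if a = b then 1 else 0))"
proof -
  obtain N :: nat where "Re (\<Sum>i<n. P i i) \<le> real N" using real_arch_simple by blast
  then show ?thesis using assms
  proof (induction N arbitrary: P)
    case (0 P)
    note diag = orthogonal_projection_diagonal[OF "0.prems"(2)]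
    have "(\<Sum>i<n. \<Sum>l<n. (cmod (P i l))\<^sup>2) \<le> 0"
      using "0.prems"(1) by (simp add: diag)
    then have "(\<Sum>i<n. \<Sum>l<n. (cmod (P i l))\<^sup>2) = 0"
      by (intro antisym sum_nonneg) auto
    then have "P i j = 0" if "i < n" "j < n" for i j
      using that by (simp add: sum_nonneg_eq_0_iff sum_nonneg)
    then show ?case by (intro exI[of _ 0]) auto
  next
    case (Suc N P)
    note diag = orthogonal_projection_diagonal[OF Suc.prems(2)]
    have herm: "cnj (P i j) = P j i" if "i < n" "j < n" for i j
      using Suc.prems(2) that unfolding orthogonal_projection_def by metis
    have idem: "(\<Sum>l<n. P i l * P l j) = P i j" if "i < n" "j < n" for i j
      using Suc.prems(2) that unfolding orthogonal_projection_def by blast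
    show ?case
    proof (cases "\<forall>j<n. P j j = 0")
      case True
      have "P i j = 0" if "i < n" "j < n" for i j
      proof -
        have "P i i = 0" using True that(1) by blast
        then have "(\<Sum>l<n. (cmod (P i l))\<^sup>2) = 0"
          unfolding diag[OF that(1)] by (simp only: of_real_eq_0_iff)
        then show ?thesis using that by (simp add: sum_nonneg_eq_0_iff)
      qed
      then show ?thesis by (intro exI[of _ 0]) auto
    next
      case False
      then obtain s where s: "s < n" "P s s \<noteq> 0" by blast
      define r where "r = (\<Sum>l<n. (cmod (P s l))\<^sup>2)"
      have Pss: "P s s = complex_of_real r" using diag[OF s(1)] by (simp add: r_def)
      have "r \<ge> 0" by (simp add: r_def sum_nonneg)
      with Pss s have r: "r > 0" by (cases "r = 0") auto
      \<comment> \<open>The norm of column \<open>s\<close> is \<open>sqrt (P s s)\<close>, again because \<open>P = P P\<^sup>*\<close>.\<close>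
      define w where "w i = P i s / complex_of_real (sqrt r)" for i
      have sq: "complex_of_real (sqrt r) * complex_of_real (sqrt r) = complex_of_real r"
        using r by (simp flip: of_real_mult)
      have ww: "w i * cnj (w j) = P i s * P s j / complex_of_real r" if "i < n" "j < n" for i j
        using that s herm[of j s] by (simp add: w_def sq)
      have Pw: "(\<Sum>l<n. P i l * w l) = w i" if "i < n" for i
        using idem[OF that s(1)] by (simp add: w_def flip: sum_divide_distrib)
      have w1: "(\<Sum>l<n. w l * cnj (w l)) = 1"
      proof -
        have "(\<Sum>l<n. w l * cnj (w l)) = (\<Sum>l<n. P s l * P l s) / complex_of_real r"
          by (simp add: ww sum_divide_distrib mult.commute)
        then show ?thesis using idem[OF s(1) s(1)] Pss r by simp
      qed
      have wP: "(\<Sum>l<n. cnj (w l) * P l j) = cnj (w j)" if "j < n" for j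
      proof -
        have "(\<Sum>l<n. cnj (w l) * P l j) = cnj (\<Sum>l<n. P j l * w l)"
          using that herm by (simp add: mult.commute) 
        then show ?thesis using Pw[OF that] by simp
      qed
      define P' where "P' i j = P i j - w i * cnj (w j)" for i j
      have herm': "cnj (P' i j) = P' j i" if "i < n" "j < n" for i j
        using herm[OF that] by (simp add: P'_def mult.commute)
      have P'w: "(\<Sum>l<n. P' i l * w l) = 0" if "i < n" for i
      proof -
        have "(\<Sum>l<n. P' i l * w l) = (\<Sum>l<n. P i l * w l) - w i * (\<Sum>l<n. w l * cnj (w l))"
          by (simp add: P'_def algebra_simps sum_subtractf sum_distrib_left)
        then show ?thesis using Pw[OF that] w1 by simp
      qed
      have idem': "(\<Sum>l<n. P' i l * P' l j) = P' i j" if "i < n" "j < n" for i j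
      proof -
        have "(\<Sum>l<n. P' i l * P' l j)
            = (\<Sum>l<n. P i l * P l j) - w i * (\<Sum>l<n. cnj (w l) * P l j)
              - (\<Sum>l<n. P' i l * w l) * cnj (w j)"
        proof -
          have "P' i l * P' l j = P i l * P l j - w i * (cnj (w l) * P l j) - P' i l * w l * cnj (w j)" for l
            by (simp add: P'_def algebra_simps)
          then show ?thesis by (simp add: sum_subtractf sum_distrib_left sum_distrib_right)
        qed
        then show ?thesis using idem[OF that] P'w[OF that(1)] wP[OF that(2)] by (simp add: P'_def)
      qed
      have "(\<Sum>i<n. P' i i) = (\<Sum>i<n. P i i) - 1"
        using w1 by (simp add: P'_def sum_subtractf)
      then have "Re (\<Sum>i<n. P' i i) \<le> real N"
        using Suc.prems(1) by simp
      moreover have "orthogonal_projection n P'"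
        using herm' idem' unfolding orthogonal_projection_def by metis
      ultimately obtain k and v :: "nat \<Rightarrow> nat \<Rightarrow> complex" where
        v1: "\<And>i j. i < n \<Longrightarrow> j < n \<Longrightarrow> P' i j = (\<Sum>a<k. v a i * cnj (v a j))" and
        v2: "\<And>a b. a < k \<Longrightarrow> b < k \<Longrightarrow> (\<Sum>i<n. v a i * cnj (v b i)) = (if a = b then 1 else 0)"
        using Suc.IH[of P'] by blast
      \<comment> \<open>The range of \<open>P'\<close> contains every \<open>v a\<close> while \<open>P'\<close> annihilates \<open>w\<close>, so self-adjointness of \<open>P'\<close> makes them orthogonal.\<close>
      have vw: "(\<Sum>i<n. v a i * cnj (w i)) = 0" if a: "a < k" for a
      proof -
        have v: "v a i = (\<Sum>l<n. P' i l * v a l)" if i: "i < n" for i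
        proof -
          have "(\<Sum>l<n. P' i l * v a l) = (\<Sum>l<n. \<Sum>b<k. v b i * (v a l * cnj (v b l)))"
            using i by (simp add: v1 sum_distrib_right sum_distrib_left mult_ac)
          also have "\<dots> = (\<Sum>b<k. v b i * (\<Sum>l<n. v a l * cnj (v b l)))"
            by (subst sum.swap) (simp add: sum_distrib_left)
          also have "\<dots> = (\<Sum>b<k. if a = b then v a i else 0)"
            using a by (intro sum.cong) (auto simp: v2)
          finally show ?thesis using a by simp
        qed
        have "(\<Sum>i<n. v a i * cnj (w i)) = (\<Sum>i<n. (\<Sum>l<n. P' i l * v a l) * cnj (w i))"
          by (intro sum.cong refl arg_cong2[where f = "(*)"] v) simp
        also have "\<dots> = (\<Sum>i<n. \<Sum>l<n. v a l * cnj (P' l i * w i))"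
          by (simp add: herm' sum_distrib_left sum_distrib_right mult_ac)
        also have "\<dots> = (\<Sum>l<n. v a l * cnj (\<Sum>i<n. P' l i * w i))"
          by (subst sum.swap) (simp add: sum_distrib_left)
        also have "\<dots> = 0" using P'w by simp
        finally show ?thesis .
      qed
      have wv: "(\<Sum>i<n. w i * cnj (v a i)) = 0" if a: "a < k" for a
      proof -
        have "(\<Sum>i<n. w i * cnj (v a i)) = cnj (\<Sum>i<n. v a i * cnj (w i))"
          by (simp add: mult.commute)
        then show ?thesis using vw[OF a] by simp
      qed
      define u where "u a = (if a < k then v a else w)" for a
      show ?thesis
      proof (intro exI[of _ "Suc k"] exI[of _ u] conjI allI impI)
        fix i j assume "i < n" "j < n"
        then show "P i j = (\<Sum>a<Suc k. u a i * cnj (u a j))"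
          using v1[of i j] by (simp add: u_def P'_def algebra_simps)
      next
        fix a b assume "a < Suc k" "b < Suc k"
        then show "(\<Sum>i<n. u a i * cnj (u b i)) = (if a = b then 1 else 0)"
          using v2 vw wv w1 by (auto simp: u_def)
      qed
    qed
  qed
qed

lemma cinner_sum:
  fixes x y :: "complex vec"
  assumes "x \<in> carrier_vec k" "y \<in> carrier_vec k"
  shows "x \<bullet>c y = (\<Sum>a<k. x $ a * cnj (y $ a))"
  using assms by (simp add: scalar_prod_def atLeast0LessThan)

lemma cinner_cnj:
  fixes x y :: "complex vec"
  assumes "x \<in> carrier_vec k" "y \<in> carrier_vec k"
  shows "cnj (x \<bullet>c y) = y \<bullet>c x"
  using assms by (simp add: cinner_sum[of _ k] mult.commute)

lemma cvec_norm_square: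
  assumes "x \<in> carrier_vec k"
  shows "complex_of_real ((cvec_norm x)\<^sup>2) = x \<bullet>c x"
proof -
  have "x \<bullet>c x = complex_of_real (\<Sum>a<k. (cmod (x $ a))\<^sup>2)"
    using assms by (simp add: cinner_sum[of _ k] cmod_square_of_real)
  then show ?thesis by (simp add: cvec_norm_def sum_nonneg)
qed

text \<open>
  A sesquilinear form that vanishes on the diagonal vanishes: \<open>D\<close> is the difference of the two sides,
  and expanding it at \<open>x + y\<close> and at \<open>x + \<i> y\<close> isolates \<open>D x y\<close>.
\<close>

lemma parseval_frame_polarized:
  assumes pf: "parseval_frame n k f" and x: "x \<in> carrier_vec k" and y: "y \<in> carrier_vec k"
  shows "(\<Sum>l<n. (x \<bullet>c f l) * (f l \<bullet>c y)) = x \<bullet>c y"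
proof -
  have f: "f l \<in> carrier_vec k" if "l < n" for l using pf that by (simp add: parseval_frame_def)
  define D where "D x y = (\<Sum>l<n. (x \<bullet>c f l) * (f l \<bullet>c y)) - x \<bullet>c y" for x y
  have D0: "D z z = 0" if z: "z \<in> carrier_vec k" for z
  proof -
    have "(\<Sum>l<n. (z \<bullet>c f l) * (f l \<bullet>c z)) = complex_of_real (\<Sum>l<n. (cmod (z \<bullet>c f l))\<^sup>2)"
      using f z by (simp add: cmod_square_of_real cinner_cnj[of _ k])
    also have "(\<Sum>l<n. (cmod (z \<bullet>c f l))\<^sup>2) = (cvec_norm z)\<^sup>2"
      using pf z by (simp add: parseval_frame_def)
    finally show ?thesis by (simp only: D_def cvec_norm_square[OF z] diff_self)
  qed
  have add: "D (x + c \<cdot>\<^sub>v y) (x + c \<cdot>\<^sub>v y) = D x x + cnj c * D x y + c * D y x + c * cnj c * D y y" for c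
  proof -
    have l: "(x + c \<cdot>\<^sub>v y) \<bullet>c z = x \<bullet>c z + c * (y \<bullet>c z)" if "z \<in> carrier_vec k" for z
      using x y that by (simp add: cinner_sum[of _ k] algebra_simps sum.distrib sum_distrib_left)
    have r: "z \<bullet>c (x + c \<cdot>\<^sub>v y) = z \<bullet>c x + cnj c * (z \<bullet>c y)" if "z \<in> carrier_vec k" for z
      using x y that by (simp add: cinner_sum[of _ k] algebra_simps sum.distrib sum_distrib_left)
    have xy: "x + c \<cdot>\<^sub>v y \<in> carrier_vec k" using x y by simp
    have "(\<Sum>l<n. ((x + c \<cdot>\<^sub>v y) \<bullet>c f l) * (f l \<bullet>c (x + c \<cdot>\<^sub>v y)))
       = (\<Sum>l<n. (x \<bullet>c f l + c * (y \<bullet>c f l)) * (f l \<bullet>c x + cnj c * (f l \<bullet>c y)))"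
      using f by (intro sum.cong) (auto simp: l r)
    then show ?thesis unfolding D_def l[OF xy] r[OF x] r[OF y]
      by (simp add: algebra_simps sum.distrib sum_distrib_left)
  qed
  have "D x y + D y x = 0"
    using add[of 1] x y by (simp add: D0)
  moreover have "- \<i> * D x y + \<i> * D y x = 0"
    using add[of \<i>] x y by (simp add: D0)
  then have "D y x = D x y" by simp
  ultimately have "D x y = 0" by simp
  then show ?thesis by (simp add: D_def)
qed

text \<open>
  The Parseval identity only asks that the coordinates \<open>j \<mapsto> f j $ a\<close> be orthonormal in \<open>\<complex>\<^sup>n\<close>, since the
  left side is a quadratic form in \<open>x\<close> whose matrix collects their inner products.
\<close>

lemma parseval_frameI:
  assumes f: "\<And>j. j < n \<Longrightarrow> f j \<in> carrier_vec k"
    and orth: "\<And>a b. a < k \<Longrightarrow> b < k \<Longrightarrow>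
      (\<Sum>j<n. cnj (f j $ a) * f j $ b) = (if a = b then 1 else 0)"
  shows "parseval_frame n k f"
  unfolding parseval_frame_def
proof (intro conjI allI impI ballI)
  fix x :: "complex vec" assume x: "x \<in> carrier_vec k"
  have "complex_of_real (\<Sum>j<n. (cmod (x \<bullet>c f j))\<^sup>2)
      = (\<Sum>j<n. (\<Sum>a<k. x $ a * cnj (f j $ a)) * (\<Sum>b<k. f j $ b * cnj (x $ b)))"
    using f x by (simp add: cmod_square_of_real cinner_sum[of _ k] mult.commute)
  also have "\<dots> = (\<Sum>j<n. \<Sum>a<k. \<Sum>b<k. x $ a * cnj (x $ b) * (cnj (f j $ a) * f j $ b))"
    by (simp add: sum_product mult_ac)
  also have "\<dots> = (\<Sum>a<k. \<Sum>b<k. \<Sum>j<n. x $ a * cnj (x $ b) * (cnj (f j $ a) * f j $ b))"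
    by (subst sum.swap, rule sum.cong[OF refl], rule sum.swap)
  also have "\<dots> = (\<Sum>a<k. \<Sum>b<k. if a = b then x $ a * cnj (x $ b) else 0)"
    by (intro sum.cong refl) (simp add: orth flip: sum_distrib_left)
  also have "\<dots> = (\<Sum>a<k. x $ a * cnj (x $ a))"
    by (intro sum.cong refl) simp
  also have "\<dots> = complex_of_real ((cvec_norm x)\<^sup>2)"
    using x by (simp only: cvec_norm_square cinner_sum[of _ k])
  finally show "(\<Sum>j<n. (cmod (x \<bullet>c f j))\<^sup>2) = (cvec_norm x)\<^sup>2"
    by (simp only: of_real_eq_iff)
qed (fact f)


section \<open>Signature matrices and the quadratic equation\<close>

lemma mat_adjoint_eq_self_iff:
  assumes Q: "Q \<in> carrier_mat n n"
  shows "mat_adjoint Q = Q \<longleftrightarrow> (\<forall>i<n. \<forall>j<n. cnj (Q $$ (i, j)) = Q $$ (j, i))"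
proof -
  have d: "dim_row Q = n" "dim_col Q = n" using Q by simp_all
  have entry: "mat_adjoint Q $$ (j, i) = cnj (Q $$ (i, j))" if "i < n" "j < n" for i j
    unfolding mat_adjoint_def using d that by (simp add: mat_of_rows_index)
  have car: "mat_adjoint Q \<in> carrier_mat n n"
    unfolding mat_adjoint_def using d by (intro carrier_matI) simp_all
  show ?thesis
  proof
    assume self: "mat_adjoint Q = Q"
    show "\<forall>i<n. \<forall>j<n. cnj (Q $$ (i, j)) = Q $$ (j, i)"
    proof (intro allI impI)
      fix i j assume "i < n" "j < n"
      from entry[OF this] show "cnj (Q $$ (i, j)) = Q $$ (j, i)" unfolding self by (rule sym)
    qed
  next
    assume *: "\<forall>i<n. \<forall>j<n. cnj (Q $$ (i, j)) = Q $$ (j, i)"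
    show "mat_adjoint Q = Q"
    proof (rule eq_matI)
      fix i j assume "i < dim_row Q" "j < dim_col Q"
      then have "i < n" "j < n" by (simp_all only: d)
      then show "mat_adjoint Q $$ (i, j) = Q $$ (i, j)"
        using entry[of j i] *[rule_format, of j i] by (simp only:)
    qed (use d car in auto)
  qed
qed

text \<open>
  The matrix equation \<open>Q\<^sup>2 = \<alpha> I + \<beta> Q\<close>, read entry by entry.
\<close>

definition satisfies_quadratic :: "nat \<Rightarrow> complex \<Rightarrow> complex \<Rightarrow> complex mat \<Rightarrow> bool" where
  "satisfies_quadratic n \<alpha> \<beta> Q \<longleftrightarrow>
     (\<forall>i<n. \<forall>j<n. (\<Sum>l<n. Q $$ (i, l) * Q $$ (l, j)) = (if i = j then \<alpha> else 0) + \<beta> * Q $$ (i, j))"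

text \<open>
  For \<open>P = \<kappa> I + c Q\<close> the difference \<open>P\<^sup>2 - P\<close> is \<open>c\<^sup>2 Q\<^sup>2 - (\<kappa> - \<kappa>\<^sup>2) I - c (1 - 2 \<kappa>) Q\<close>, and the two
  hypotheses on \<open>\<kappa>\<close> turn it into \<open>c\<^sup>2 (Q\<^sup>2 - N I - \<nu> Q)\<close>.
\<close>

lemma affine_idempotent_iff:
  fixes \<kappa> c \<nu> N :: complex
  assumes c: "c \<noteq> 0" and N: "\<kappa> - \<kappa>\<^sup>2 = c\<^sup>2 * N" and \<nu>: "1 - 2 * \<kappa> = c * \<nu>"
    and P: "\<And>i j. i < n \<Longrightarrow> j < n \<Longrightarrow> P i j = (if i = j then \<kappa> else 0) + c * Q $$ (i, j)"
  shows "(\<forall>i<n. \<forall>j<n. (\<Sum>l<n. P i l * P l j) = P i j) \<longleftrightarrow> satisfies_quadratic n N \<nu> Q"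
proof -
  have "(\<Sum>l<n. P i l * P l j) = P i j \<longleftrightarrow>
      (\<Sum>l<n. Q $$ (i, l) * Q $$ (l, j)) = (if i = j then N else 0) + \<nu> * Q $$ (i, j)"
    (is "_ \<longleftrightarrow> ?S = ?R") if ij: "i < n" "j < n" for i j
  proof -
    have "(\<Sum>l<n. P i l * P l j)
        = (\<Sum>l<n. (if i = l then \<kappa> * ((if l = j then \<kappa> else 0) + c * Q $$ (l, j)) else 0)
             + (if l = j then c * Q $$ (i, l) * \<kappa> else 0)
             + c\<^sup>2 * (Q $$ (i, l) * Q $$ (l, j)))"
      using ij by (intro sum.cong) (auto simp: P algebra_simps power2_eq_square)
    also have "\<dots> = (if i = j then \<kappa>\<^sup>2 else 0) + 2 * \<kappa> * c * Q $$ (i, j) + c\<^sup>2 * ?S"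
      using ij by (simp add: sum.distrib algebra_simps power2_eq_square flip: sum_distrib_left)
    finally have "(\<Sum>l<n. P i l * P l j) - P i j
        = c\<^sup>2 * ?S - ((if i = j then \<kappa> - \<kappa>\<^sup>2 else 0) + c * (1 - 2 * \<kappa>) * Q $$ (i, j))"
      using ij by (simp add: P algebra_simps)
    also have "\<dots> = c\<^sup>2 * (?S - ?R)"
      unfolding N \<nu> by (simp add: algebra_simps power2_eq_square)
    finally show ?thesis using c by auto
  qed
  then show ?thesis by (auto simp: satisfies_quadratic_def)
qed

text \<open>
  The coefficient \<open>\<nu>\<close> in \<open>Q\<^sup>2 = (n - 1) I + \<nu> Q\<close>, which is the sum of the two eigenvalues of a
  signature matrix \<open>Q\<close>.
\<close>

definition frame_eigenvalue_sum :: "nat \<Rightarrow> nat \<Rightarrow> real" where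
  "frame_eigenvalue_sum n k =
     (real n - 2 * real k) * sqrt ((real n - 1) / (real k * (real n - real k)))"

text \<open>
  These are the hypotheses of \<open>affine_idempotent_iff\<close> for the coefficients \<open>\<kappa> = k / n\<close> and \<open>c\<close> of the
  Gram matrix of an equiangular frame.
\<close>

lemma frame_const_relations:
  assumes k: "1 \<le> k" "k < n"
  defines "\<kappa> \<equiv> real k / real n" and "c \<equiv> frame_const n k"
  shows "c > 0" and "\<kappa> - \<kappa>\<^sup>2 = c\<^sup>2 * (real n - 1)" and "1 - 2 * \<kappa> = c * frame_eigenvalue_sum n k"
proof -
  have pos: "real n > 1" "real k > 0" "real n - real k > 0" "real n - 1 > 0" using k by linarith+
  then have c2: "c\<^sup>2 = real k * (real n - real k) / ((real n)\<^sup>2 * (real n - 1))"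
    by (simp add: c_def frame_const_def)
  show "c > 0" using pos by (simp add: c_def frame_const_def)
  have "c\<^sup>2 * (real n - 1) = real k * (real n - real k) / (real n)\<^sup>2"
    using pos by (simp add: c2)
  also have "\<dots> = \<kappa> - \<kappa>\<^sup>2"
    using pos by (simp add: \<kappa>_def field_simps power2_eq_square)
  finally show "\<kappa> - \<kappa>\<^sup>2 = c\<^sup>2 * (real n - 1)" by simp
  have "c * sqrt ((real n - 1) / (real k * (real n - real k))) = sqrt ((1 / real n)\<^sup>2)"
    using pos by (simp add: c_def frame_const_def power_divide flip: real_sqrt_mult)
  also have "\<dots> = 1 / real n" by simp
  finally have *: "c * sqrt ((real n - 1) / (real k * (real n - real k))) = 1 / real n" .
  have "c * frame_eigenvalue_sum n k
      = (real n - 2 * real k) * (c * sqrt ((real n - 1) / (real k * (real n - real k))))"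
    by (simp add: frame_eigenvalue_sum_def)
  also have "\<dots> = 1 - 2 * \<kappa>" using pos unfolding * by (simp add: \<kappa>_def field_simps)
  finally show "1 - 2 * \<kappa> = c * frame_eigenvalue_sum n k" by simp
qed

text \<open>
  Eliminating \<open>\<kappa> = k / n\<close> from \<open>\<kappa> - \<kappa>\<^sup>2 = c\<^sup>2 (n - 1)\<close> and \<open>1 - 2 \<kappa> = c \<nu>\<close> gives
  \<open>c\<^sup>2 (4 (n - 1) + \<nu>\<^sup>2) = 1\<close>, so the square root is \<open>1 / c\<close> and \<open>\<kappa> = (1 - c \<nu>) / 2\<close>.
\<close>

lemma frame_dimension_from_eigenvalue_sum:
  assumes k: "1 \<le> k" "k < n" and \<nu>: "\<nu> = frame_eigenvalue_sum n k"
  shows "real k = real n / 2 - \<nu> * real n / (2 * sqrt (4 * (real n - 1) + \<nu>\<^sup>2))"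
proof -
  define \<kappa> where "\<kappa> = real k / real n"
  define c where "c = frame_const n k"
  note rel = frame_const_relations[OF k, folded \<kappa>_def c_def \<nu>]
  have "c\<^sup>2 * (4 * (real n - 1) + \<nu>\<^sup>2) = 4 * (c\<^sup>2 * (real n - 1)) + (c * \<nu>)\<^sup>2"
    by (simp add: algebra_simps power_mult_distrib)
  also have "\<dots> = 1"
    unfolding rel(2,3)[symmetric] by (simp add: power2_eq_square algebra_simps)
  finally have "4 * (real n - 1) + \<nu>\<^sup>2 = (1 / c)\<^sup>2"
    using rel(1) by (simp add: field_simps)
  then have s: "sqrt (4 * (real n - 1) + \<nu>\<^sup>2) = 1 / c" using rel(1) by simp
  have "\<nu> * real n / (2 * sqrt (4 * (real n - 1) + \<nu>\<^sup>2)) = (c * \<nu>) * real n / 2"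
    unfolding s by simp
  also have "\<dots> = real n / 2 - real k"
    unfolding rel(3)[symmetric] using k by (simp add: \<kappa>_def field_simps)
  finally show ?thesis by simp
qed

text \<open>
  Polarizing the Parseval identity at two frame vectors says that the Gram matrix is idempotent,
  which for \<open>P = (k / n) I + c Q\<close> is the quadratic equation.
\<close>

lemma signature_matrix_satisfies_quadratic:
  assumes "signature_matrix n k Q"
  shows "satisfies_quadratic n (of_real (real n - 1)) (of_real (frame_eigenvalue_sum n k)) Q"
proof -
  from assms obtain f where k: "1 \<le> k" "k < n" and Q: "Q \<in> carrier_mat n n"
    and f: "equiangular_frame n k f"
    and gram: "gram_matrix n f = complex_of_real (real k / real n) \<cdot>\<^sub>m 1\<^sub>m n +
          complex_of_real (frame_const n k) \<cdot>\<^sub>m Q"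
    by (auto simp: signature_matrix_def)
  define \<kappa> where "\<kappa> = real k / real n"
  define c where "c = frame_const n k"
  note rel = frame_const_relations[OF k, folded \<kappa>_def c_def]
  define P where "P i j = f j \<bullet>c f i" for i j
  have pf: "parseval_frame n k f" using f by (simp add: equiangular_frame_def)
  then have car: "f j \<in> carrier_vec k" if "j < n" for j
    using that by (simp add: parseval_frame_def)
  have P: "P i j = (if i = j then of_real \<kappa> else 0) + of_real c * Q $$ (i, j)"
    if "i < n" "j < n" for i j
    using arg_cong[OF gram, of "\<lambda>A. A $$ (i, j)"] that Q
    by (simp add: gram_matrix_def P_def \<kappa>_def c_def)
  have idem: "(\<Sum>l<n. P i l * P l j) = P i j" if "i < n" "j < n" for i j
    using parseval_frame_polarized[OF pf car car, OF that(2,1)] by (simp add: P_def mult.commute)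
  have "complex_of_real c \<noteq> 0"
    and "complex_of_real \<kappa> - (complex_of_real \<kappa>)\<^sup>2
      = (complex_of_real c)\<^sup>2 * complex_of_real (real n - 1)"
    and "1 - 2 * complex_of_real \<kappa>
      = complex_of_real c * complex_of_real (frame_eigenvalue_sum n k)"
    using rel(1) arg_cong[OF rel(2), of complex_of_real] arg_cong[OF rel(3), of complex_of_real]
    by simp_all
  from affine_idempotent_iff[OF this, of n P Q] P idem show ?thesis by blast
qed

lemma cvec_norm_nonneg: "cvec_norm x \<ge> 0" if "x \<in> carrier_vec k" 
  using that by (simp add: cvec_norm_def cinner_sum[of _ k] sum_nonneg)

lemma normalized_inner:
  assumes x: "x \<in> carrier_vec k" and y: "y \<in> carrier_vec k"
  shows "cmod (normalized x \<bullet>c normalized y) = cmod (x \<bullet>c y) / (cvec_norm x * cvec_norm y)"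
proof -
  have "normalized x \<bullet>c normalized y
      = complex_of_real (1 / (cvec_norm x * cvec_norm y)) * (x \<bullet>c y)"
    using x y by (simp add: normalized_def cinner_sum[of _ k] sum_distrib_left mult_ac)
  then show ?thesis
    using cvec_norm_nonneg[OF x] cvec_norm_nonneg[OF y] by (simp add: norm_mult norm_divide)
qed

text \<open>
  The equation makes \<open>P = \<kappa> I + c Q\<close> an orthogonal projection once \<open>c\<close> is the reciprocal of the
  difference \<open>s\<close> of the roots of \<open>t\<^sup>2 = n - 1 + \<nu> t\<close> and \<open>\<kappa> = (1 - c \<nu>) / 2\<close>: it is the projection onto the
  eigenspace of the larger root. Its trace \<open>n \<kappa>\<close> is the number \<open>k\<close> of basis vectors of its
  range, which identifies \<open>\<kappa>\<close> with \<open>k / n\<close> and then \<open>c\<close> with the frame constant.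
\<close>

lemma satisfies_quadratic_imp_signature_matrix:
  assumes n: "n \<ge> 2" and Q: "Q \<in> carrier_mat n n" and adj: "mat_adjoint Q = Q"
    and diag: "\<And>i. i < n \<Longrightarrow> Q $$ (i, i) = 0"
    and unimod: "\<And>i j. i < n \<Longrightarrow> j < n \<Longrightarrow> i \<noteq> j \<Longrightarrow> cmod (Q $$ (i, j)) = 1"
    and quad: "satisfies_quadratic n (of_real (real n - 1)) (complex_of_real \<nu>) Q"
  shows "\<exists>k. signature_matrix n k Q"
proof -
  define s where "s = sqrt (4 * (real n - 1) + \<nu>\<^sup>2)"
  define c where "c = 1 / s"
  define \<kappa> where "\<kappa> = (1 - c * \<nu>) / 2"
  have n1: "real n - 1 > 0" using n by linarith
  have rad: "4 * (real n - 1) + \<nu>\<^sup>2 > 0" using n1 by (simp add: add_pos_nonneg)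
  then have s: "s > 0" "s\<^sup>2 = 4 * (real n - 1) + \<nu>\<^sup>2" by (simp_all add: s_def)
  have c: "c > 0" using s by (simp add: c_def)
  have "c\<^sup>2 * s\<^sup>2 = 1"
    using s(1) by (simp add: c_def power_divide)
  then have "c\<^sup>2 * (4 * (real n - 1) + \<nu>\<^sup>2) = 1" by (simp only: s(2))
  then have \<kappa>2: "\<kappa> - \<kappa>\<^sup>2 = c\<^sup>2 * (real n - 1)"
    by (simp add: \<kappa>_def power2_eq_square field_simps)
  have \<kappa>1: "1 - 2 * \<kappa> = c * \<nu>" by (simp add: \<kappa>_def field_simps)
  have "\<kappa> * (1 - \<kappa>) = c\<^sup>2 * (real n - 1)"
    using \<kappa>2 by (simp add: power2_eq_square algebra_simps)
  then have "\<kappa> * (1 - \<kappa>) > 0" using c n1 by simp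
  then have \<kappa>01: "0 < \<kappa>" "\<kappa> < 1" by (auto simp: zero_less_mult_iff)
  define P where "P i j = (if i = j then of_real \<kappa> else 0) + complex_of_real c * Q $$ (i, j)" for i j
  have herm: "P j i = cnj (P i j)" if "i < n" "j < n" for i j
    using adj that unfolding mat_adjoint_eq_self_iff[OF Q] by (auto simp: P_def)
  have "complex_of_real c \<noteq> 0"
    and "complex_of_real \<kappa> - (complex_of_real \<kappa>)\<^sup>2
      = (complex_of_real c)\<^sup>2 * complex_of_real (real n - 1)"
    and "1 - 2 * complex_of_real \<kappa> = complex_of_real c * complex_of_real \<nu>"
    using c arg_cong[OF \<kappa>2, of complex_of_real] arg_cong[OF \<kappa>1, of complex_of_real]
    by simp_all
  from affine_idempotent_iff[OF this, of n P Q] quad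
  have "orthogonal_projection n P"
    using herm unfolding orthogonal_projection_def by (simp add: P_def)
  from orthogonal_projection_factorization[OF this]
  obtain k and v :: "nat \<Rightarrow> nat \<Rightarrow> complex" where
    v1: "\<And>i j. i < n \<Longrightarrow> j < n \<Longrightarrow> P i j = (\<Sum>a<k. v a i * cnj (v a j))" and
    v2: "\<And>a b. a < k \<Longrightarrow> b < k \<Longrightarrow> (\<Sum>i<n. v a i * cnj (v b i)) = (if a = b then 1 else 0)"
    by blast
  have Pii: "P i i = of_real \<kappa>" if "i < n" for i using diag[OF that] by (simp add: P_def)
  \<comment> \<open>The trace of \<open>P\<close> is computed from its diagonal and from the orthonormal basis of its range.\<close>
  have "complex_of_real (real n * \<kappa>) = (\<Sum>i<n. P i i)" by (simp add: Pii)
  also have "\<dots> = (\<Sum>i<n. \<Sum>a<k. v a i * cnj (v a i))" by (simp add: v1)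
  also have "\<dots> = (\<Sum>a<k. \<Sum>i<n. v a i * cnj (v a i))" by (rule sum.swap)
  also have "\<dots> = complex_of_real (real k)" by (simp add: v2)
  finally have nk: "real n * \<kappa> = real k" by (simp only: of_real_eq_iff)
  then have \<kappa>k: "\<kappa> = real k / real n" using n by (simp add: field_simps)
  have "real k > 0" "real k < real n"
    using \<kappa>01 n by (simp_all add: \<kappa>k zero_less_divide_iff divide_less_eq)
  then have k: "1 \<le> k" "k < n" by simp_all
  have "(frame_const n k)\<^sup>2 = c\<^sup>2"
    using frame_const_relations(2)[OF k] \<kappa>2 n1 by (simp add: \<kappa>k)
  then have fc: "frame_const n k = c"
    using frame_const_relations(1)[OF k] c by (simp add: power2_eq_iff_nonneg)
  \<comment> \<open>The conjugation makes \<open>f j \<bullet>c f i\<close>, and not its conjugate, equal to \<open>P i j\<close>.\<close>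
  define f where "f j = vec k (\<lambda>a. cnj (v a j))" for j
  have f: "f j \<in> carrier_vec k" for j by (simp add: f_def)
  have inner: "f j \<bullet>c f i = P i j" if "i < n" "j < n" for i j
    using that by (simp add: cinner_sum[OF f f]) (simp add: f_def v1 mult.commute)
  have norm: "cvec_norm (f i) = sqrt \<kappa>" if "i < n" for i
    using that by (simp add: cvec_norm_def inner Pii)
  have "parseval_frame n k f"
    using v2 by (intro parseval_frameI f) (simp add: f_def)
  moreover have "f i \<noteq> 0\<^sub>v k" if "i < n" for i
    using inner[OF that that] Pii[OF that] \<kappa>01(1) by auto
  moreover have "cmod (normalized (f i) \<bullet>c normalized (f j)) = c / \<kappa>"
    if "i < n" "j < n" "i \<noteq> j" for i j
    using that c \<kappa>01(1) unimod[of j i]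
    by (simp add: normalized_inner[OF f f] norm inner P_def norm_mult)
  ultimately have "equiangular_frame n k f"
    by (auto simp: equiangular_frame_def)
  moreover have "gram_matrix n f = complex_of_real (real k / real n) \<cdot>\<^sub>m 1\<^sub>m n +
      complex_of_real (frame_const n k) \<cdot>\<^sub>m Q"
    using Q by (intro eq_matI) (auto simp: gram_matrix_def inner P_def fc \<kappa>k)
  ultimately show ?thesis
    using k Q adj diag unimod unfolding signature_matrix_def by blast
qed


section \<open>Signed partitions of a finite group\<close>

locale signed_partition = group G for G (structure) +
  fixes e :: "nat \<Rightarrow> 'a" and S T :: "'a set"
  assumes finite_carrier: "finite (carrier G)"
    and enumeration: "bij_betw e {..<Coset.order G} (carrier G)"
    and S_subset: "S \<subseteq> carrier G - {\<one>}"
    and T_eq: "T = carrier G - {\<one>} - S"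
begin

definition sign :: "'a \<Rightarrow> int" where
  "sign x = of_bool (x \<in> S) - of_bool (x \<in> T)"

text \<open>
  The convolution of \<open>sign\<close> with itself, in terms of numbers of factorizations.
\<close>

definition signed_count :: "'a \<Rightarrow> int" where
  "signed_count x = int (num_factorizations G S S x) - 2 * int (num_factorizations G S T x)
     + int (num_factorizations G T T x)"

lemma partition:
  "S \<subseteq> carrier G" "T \<subseteq> carrier G" "S \<inter> T = {}" "\<one> \<notin> S" "\<one> \<notin> T"
  "carrier G = insert \<one> (S \<union> T)"
  using S_subset T_eq by auto

lemma sign_values:
  "sign \<one> = 0" "x \<in> S \<Longrightarrow> sign x = 1" "x \<in> T \<Longrightarrow> sign x = - 1"
  using partition(3-5) by (auto simp: sign_def)

lemma sign_cases:
  assumes "x \<in> carrier G"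
  obtains "x = \<one>" "sign x = 0" | "x \<in> S" "x \<noteq> \<one>" "sign x = 1" | "x \<in> T" "x \<noteq> \<one>" "sign x = - 1"
proof -
  have "x = \<one> \<or> x \<in> S \<or> x \<in> T" using assms partition(6) by auto
  then show thesis using that sign_values partition(4,5) by metis
qed

lemma enum_in_carrier: "i < Coset.order G \<Longrightarrow> e i \<in> carrier G"
  using enumeration by (auto simp: bij_betw_def)

lemma sum_enum: "(\<Sum>i<Coset.order G. F (e i)) = (\<Sum>x\<in>carrier G. F x)"
  using sum.reindex_bij_betw[OF enumeration] .

lemma sum_right_quotient:
  assumes "y \<in> carrier G"
  shows "(\<Sum>x\<in>carrier G. F (x \<otimes> inv y)) = (\<Sum>x\<in>carrier G. F x)"
  using assms
  by (intro sum.reindex_bij_witness[where i = "\<lambda>x. x \<otimes> y" and j = "\<lambda>x. x \<otimes> inv y"])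
    (auto simp: m_assoc)

lemma mult_inv_cancel:
  assumes "x \<in> carrier G" "y \<in> carrier G"
  shows "x \<otimes> (inv x \<otimes> y) = y" and "inv x \<otimes> (x \<otimes> y) = y"
  using assms by (simp_all flip: m_assoc)

lemma sum_left_quotient:
  assumes "y \<in> carrier G"
  shows "(\<Sum>x\<in>carrier G. F (inv x \<otimes> y)) = (\<Sum>x\<in>carrier G. F x)"
  using assms
  by (intro sum.reindex_bij_witness[where i = "\<lambda>x. y \<otimes> inv x" and j = "\<lambda>x. inv x \<otimes> y"])
    (auto simp: m_assoc inv_mult_group mult_inv_cancel)

lemma sum_right_divide:
  assumes "y \<in> carrier G"
  shows "(\<Sum>x\<in>carrier G. F (y \<otimes> inv x)) = (\<Sum>x\<in>carrier G. F x)"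
  using assms
  by (intro sum.reindex_bij_witness[where i = "\<lambda>x. inv x \<otimes> y" and j = "\<lambda>x. y \<otimes> inv x"])
    (auto simp: m_assoc inv_mult_group mult_inv_cancel)

text \<open>
  A factorization \<open>g = a b\<close> is determined by \<open>a\<close>, so the number of factorizations is the convolution of
  the two indicator functions.
\<close>

lemma num_factorizations_sum:
  assumes A: "A \<subseteq> carrier G" and B: "B \<subseteq> carrier G" and g: "g \<in> carrier G"
  shows "int (num_factorizations G A B g)
    = (\<Sum>a\<in>carrier G. of_bool (a \<in> A) * of_bool (inv a \<otimes> g \<in> B))"
proof -
  have "bij_betw (\<lambda>a. (a, inv a \<otimes> g)) {a \<in> carrier G. a \<in> A \<and> inv a \<otimes> g \<in> B}
      {(a, b) \<in> A \<times> B. a \<otimes> b = g}"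
    using A B g inv_solve_left
    by (intro bij_betw_byWitness[where f' = fst]) (auto simp: subset_iff simp flip: m_assoc)
  from bij_betw_same_card[OF this]
  have "num_factorizations G A B g = card {a \<in> carrier G. a \<in> A \<and> inv a \<otimes> g \<in> B}"
    by (simp add: num_factorizations_def)
  also have "int \<dots> = (\<Sum>a\<in>carrier G. of_bool (a \<in> A \<and> inv a \<otimes> g \<in> B))"
    using finite_carrier by (simp add: of_bool_def sum.If_cases Int_def)
  finally show ?thesis by (simp add: of_bool_conj)
qed

lemma of_bool_T:
  "x \<in> carrier G \<Longrightarrow> of_bool (x \<in> T) = (1 - of_bool (x \<in> S) - of_bool (x = \<one>) :: int)"
  using partition(3-6) by auto

lemma inv_mult_eq_one_iff:
  assumes "a \<in> carrier G" "x \<in> carrier G"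
  shows "inv a \<otimes> x = \<one> \<longleftrightarrow> a = x"
  using assms inv_solve_left'[of \<one> a x] by auto

text \<open>
  With \<open>\<delta>\<close> the indicator function of the identity, substituting \<open>1\<^sub>T = 1 - 1\<^sub>S - \<delta>\<close> in either
  convolution \<open>1\<^sub>S * 1\<^sub>T\<close> or \<open>1\<^sub>T * 1\<^sub>S\<close> gives \<open>|S| - 1\<^sub>S * 1\<^sub>S - 1\<^sub>S\<close>.
\<close>

lemma num_factorizations_commute:
  assumes x: "x \<in> carrier G"
  shows "num_factorizations G S T x = num_factorizations G T S x"
proof -
  let ?s = "\<lambda>a. of_bool (a \<in> S) :: int"
  note ST = partition(1,2)
  let ?SS = "\<Sum>a\<in>carrier G. ?s a * ?s (inv a \<otimes> x)"
  have "int (num_factorizations G S T x)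
      = (\<Sum>a\<in>carrier G. ?s a - ?s a * ?s (inv a \<otimes> x) - (if a = x then ?s a else 0))"
    unfolding num_factorizations_sum[OF ST x]
    by (intro sum.cong refl) (use x in \<open>auto simp: of_bool_T inv_mult_eq_one_iff algebra_simps\<close>)
  also have "\<dots> = (\<Sum>a\<in>carrier G. ?s a) - ?SS - ?s x"
    using x finite_carrier by (simp only: sum_subtractf) simp
  finally have 1: "int (num_factorizations G S T x) = (\<Sum>a\<in>carrier G. ?s a) - ?SS - ?s x" .
  have "int (num_factorizations G T S x)
      = (\<Sum>a\<in>carrier G. ?s (inv a \<otimes> x) - ?s a * ?s (inv a \<otimes> x) - (if a = \<one> then ?s (inv a \<otimes> x) else 0))"
    unfolding num_factorizations_sum[OF ST(2,1) x]
    by (intro sum.cong refl) (use x in \<open>auto simp: of_bool_T algebra_simps\<close>)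
  also have "\<dots> = (\<Sum>a\<in>carrier G. ?s (inv a \<otimes> x)) - ?SS - ?s x"
    using x finite_carrier by (simp only: sum_subtractf) simp
  also have "(\<Sum>a\<in>carrier G. ?s (inv a \<otimes> x)) = (\<Sum>a\<in>carrier G. ?s a)"
    by (rule sum_left_quotient[OF x])
  finally have "int (num_factorizations G T S x) = (\<Sum>a\<in>carrier G. ?s a) - ?SS - ?s x" .
  with 1 show ?thesis by linarith
qed

lemma signed_count_convolution:
  assumes x: "x \<in> carrier G"
  shows "(\<Sum>a\<in>carrier G. sign a * sign (inv a \<otimes> x)) = signed_count x"
proof -
  note ST = partition(1,2)
  have "(\<Sum>a\<in>carrier G. sign a * sign (inv a \<otimes> x))
      = int (num_factorizations G S S x) - int (num_factorizations G S T x)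
        - int (num_factorizations G T S x) + int (num_factorizations G T T x)"
    using ST x
    by (simp add: num_factorizations_sum sign_def algebra_simps sum.distrib sum_subtractf)
  then show ?thesis by (simp add: signed_count_def num_factorizations_commute[OF x])
qed

lemma sum_sign: "(\<Sum>x\<in>carrier G. sign x) = int (card S) - int (card T)"
proof -
  have "carrier G \<inter> {x. x \<in> A} = A" if "A \<subseteq> carrier G" for A using that by auto
  then show ?thesis
    using finite_carrier partition(1,2) by (simp add: sign_def sum_subtractf of_bool_def sum.If_cases)
qed


lemma sign_inv_iff:
  "(\<forall>x\<in>carrier G. sign (inv x) = sign x) \<longleftrightarrow> (\<forall>g\<in>S. inv g \<in> S) \<and> (\<forall>h\<in>T. inv h \<in> T)"
proof -
  have S: "sign x = 1 \<longleftrightarrow> x \<in> S" and T: "sign x = - 1 \<longleftrightarrow> x \<in> T" for x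
    using partition(3) by (auto simp: sign_def)
  show ?thesis
  proof
    assume *: "\<forall>x\<in>carrier G. sign (inv x) = sign x"
    show "(\<forall>g\<in>S. inv g \<in> S) \<and> (\<forall>h\<in>T. inv h \<in> T)"
      using * partition(1,2) by (auto simp flip: S T)
  next
    assume *: "(\<forall>g\<in>S. inv g \<in> S) \<and> (\<forall>h\<in>T. inv h \<in> T)"
    show "\<forall>x\<in>carrier G. sign (inv x) = sign x"
    proof
      fix x assume "x \<in> carrier G"
      then show "sign (inv x) = sign x"
        using * by (cases rule: sign_cases) (auto simp: sign_values)
    qed
  qed
qed

lemma left_regular_entry:
  assumes "i < Coset.order G" "j < Coset.order G" "g \<in> carrier G"
  shows "left_regular G e g $$ (i, j) = of_bool (g = e i \<otimes> inv (e j))"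
proof -
  have "e i = g \<otimes> e j \<longleftrightarrow> g = e i \<otimes> inv (e j)"
    using inv_solve_right[of g "e i" "e j"] assms enum_in_carrier by auto
  then show ?thesis using assms by (simp add: left_regular_def)
qed

lemma left_regular_carrier: "left_regular G e g \<in> carrier_mat (Coset.order G) (Coset.order G)"
  by (simp add: left_regular_def)

text \<open>
  Each entry of the sum counts the \<open>g\<close> in \<open>A\<close> that carry \<open>e j\<close> to \<open>e i\<close>, and \<open>e i (e j)\<^sup>-\<^sup>1\<close> is the only
  group element that does so.
\<close>

lemma finsum_left_regular:
  assumes A: "A \<subseteq> carrier G"
  shows "finsum (module_mat TYPE(complex) (Coset.order G) (Coset.order G)) (left_regular G e) A
    = mat (Coset.order G) (Coset.order G) (\<lambda>(i, j). of_bool (e i \<otimes> inv (e j) \<in> A))"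
proof -
  let ?m = "Coset.order G"
  let ?M = "module_mat TYPE(complex) ?m ?m"
  interpret M: abelian_group ?M by (rule abelian_group_mat)
  have car: "left_regular G e g \<in> carrier ?M" for g
    using left_regular_carrier by (simp add: module_mat_simps)
  from finite_subset[OF A finite_carrier] A show ?thesis
  proof (induction A rule: finite_induct)
    case empty
    show ?case by (auto simp: module_mat_simps intro!: eq_matI)
  next
    case (insert g A)
    then have "finsum ?M (left_regular G e) (insert g A)
        = left_regular G e g + mat ?m ?m (\<lambda>(i, j). of_bool (e i \<otimes> inv (e j) \<in> A))"
      using car by (simp add: M.finsum_insert module_mat_simps)
    also have "\<dots> = mat ?m ?m (\<lambda>(i, j). of_bool (e i \<otimes> inv (e j) \<in> insert g A))"
      using insert.hyps(2) insert.prems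
      by (intro eq_matI) (auto simp: left_regular_entry carrier_matD[OF left_regular_carrier])
    finally show ?case .
  qed
qed

abbreviation Q :: "complex mat" where
  "Q \<equiv> signed_sum_matrix G e S T"

lemma signed_sum_entry:
  assumes "i < Coset.order G" "j < Coset.order G"
  shows "Q $$ (i, j) = of_int (sign (e i \<otimes> inv (e j)))"
  using assms partition(1,2)
  by (simp add: signed_sum_matrix_def Let_def finsum_left_regular sign_def)

lemma signed_sum_carrier: "Q \<in> carrier_mat (Coset.order G) (Coset.order G)"
  using partition(1,2)
  by (simp add: signed_sum_matrix_def Let_def finsum_left_regular minus_carrier_mat)

definition bordered :: "complex mat" where
  "bordered = bordered_matrix (Coset.order G) Q"

lemma bordered_carrier: "bordered \<in> carrier_mat (Suc (Coset.order G)) (Suc (Coset.order G))"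
  using four_block_carrier_mat[OF zero_carrier_mat signed_sum_carrier, of 1 1]
  by (simp add: bordered_def bordered_matrix_def Let_def)

lemma bordered_entries:
  "bordered $$ (0, 0) = 0"
  "j < Coset.order G \<Longrightarrow> bordered $$ (0, Suc j) = 1"
  "i < Coset.order G \<Longrightarrow> bordered $$ (Suc i, 0) = 1"
  "i < Coset.order G \<Longrightarrow> j < Coset.order G \<Longrightarrow>
    bordered $$ (Suc i, Suc j) = of_int (sign (e i \<otimes> inv (e j)))"
  by (simp_all add: bordered_def bordered_matrix_def Let_def signed_sum_entry
      carrier_matD[OF signed_sum_carrier])

lemma quotient_eq_one_iff:
  assumes "i < Coset.order G" "j < Coset.order G"
  shows "e i \<otimes> inv (e j) = \<one> \<longleftrightarrow> i = j"
proof -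
  have "e i \<otimes> inv (e j) = \<one> \<longleftrightarrow> e i = e j"
    using inv_solve_right[of \<one> "e i" "e j"] enum_in_carrier assms by auto
  then show ?thesis
    using enumeration assms by (auto simp: bij_betw_def inj_on_def)
qed

text \<open>
  The entries of a matrix that depends on its indices only through \<open>e i (e j)\<^sup>-\<^sup>1\<close> already show all their
  values in the column of the identity; matrix identities thereby become identities on the group.
\<close>

lemma all_quotients_iff:
  "(\<forall>i<Coset.order G. \<forall>j<Coset.order G. R (e i \<otimes> inv (e j))) \<longleftrightarrow> (\<forall>x\<in>carrier G. R x)"
proof
  assume *: "\<forall>i<Coset.order G. \<forall>j<Coset.order G. R (e i \<otimes> inv (e j))"
  show "\<forall>x\<in>carrier G. R x"
  proof
    fix x assume x: "x \<in> carrier G"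
    have "carrier G = e ` {..<Coset.order G}" using enumeration by (simp add: bij_betw_def)
    then have "x \<in> e ` {..<Coset.order G}" "\<one> \<in> e ` {..<Coset.order G}" using x by auto
    then obtain i j where ij: "i < Coset.order G" "x = e i" "j < Coset.order G" "\<one> = e j"
      by auto
    then have "R (e i \<otimes> inv (e j))" using * by blast
    then show "R x" using x by (simp flip: ij(2,4))
  qed
qed (use enum_in_carrier in auto)

lemma bordered_self_adjoint_iff:
  "mat_adjoint bordered = bordered \<longleftrightarrow> (\<forall>g\<in>S. inv g \<in> S) \<and> (\<forall>h\<in>T. inv h \<in> T)"
proof -
  have inv: "inv (e i \<otimes> inv (e j)) = e j \<otimes> inv (e i)"
    if "i < Coset.order G" "j < Coset.order G" for i j
    using that enum_in_carrier by (simp add: inv_mult_group)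
  have "mat_adjoint bordered = bordered \<longleftrightarrow>
      (\<forall>i<Coset.order G. \<forall>j<Coset.order G. sign (e i \<otimes> inv (e j)) = sign (e j \<otimes> inv (e i)))"
    unfolding mat_adjoint_eq_self_iff[OF bordered_carrier]
    by (simp add: All_less_Suc2 bordered_entries)
  also have "\<dots> \<longleftrightarrow> (\<forall>i<Coset.order G. \<forall>j<Coset.order G.
      sign (e i \<otimes> inv (e j)) = sign (inv (e i \<otimes> inv (e j))))"
    by (simp add: inv)
  also have "\<dots> \<longleftrightarrow> (\<forall>x\<in>carrier G. sign x = sign (inv x))"
    by (rule all_quotients_iff)
  also have "\<dots> \<longleftrightarrow> (\<forall>x\<in>carrier G. sign (inv x) = sign x)"
    by metis
  finally show ?thesis unfolding sign_inv_iff .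
qed

lemma bordered_zero_diagonal:
  assumes "i < Suc (Coset.order G)"
  shows "bordered $$ (i, i) = 0"
  using assms
  by (cases i) (simp_all add: bordered_entries enum_in_carrier sign_values(1))

lemma bordered_unimodular:
  assumes "i < Suc (Coset.order G)" "j < Suc (Coset.order G)" "i \<noteq> j"
  shows "cmod (bordered $$ (i, j)) = 1"
proof (cases i; cases j)
  fix i' j' assume ij: "i = Suc i'" "j = Suc j'"
  define x where "x = e i' \<otimes> inv (e j')"
  have "x \<in> carrier G" "x \<noteq> \<one>"
    using assms ij quotient_eq_one_iff[of i' j'] enum_in_carrier by (auto simp: x_def)
  then have "sign x = 1 \<or> sign x = - 1" by (cases rule: sign_cases) auto
  then show ?thesis using assms ij by (auto simp: bordered_entries simp flip: x_def)
qed (use assms in \<open>auto simp: bordered_entries\<close>)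

lemma sum_sign_rows:
  assumes "j < Coset.order G"
  shows "(\<Sum>l<Coset.order G. sign (e l \<otimes> inv (e j))) = int (card S) - int (card T)"
    and "(\<Sum>l<Coset.order G. sign (e j \<otimes> inv (e l))) = int (card S) - int (card T)"
  using assms enum_in_carrier
  by (simp_all add: sum_enum[of "\<lambda>x. sign (x \<otimes> inv (e j))"] sum_enum[of "\<lambda>x. sign (e j \<otimes> inv x)"]
      sum_right_quotient sum_right_divide sum_sign)

text \<open>
  In terms of \<open>a = e i (e l)\<^sup>-\<^sup>1\<close> the second factor \<open>e l (e j)\<^sup>-\<^sup>1\<close> is \<open>a\<^sup>-\<^sup>1 e i (e j)\<^sup>-\<^sup>1\<close>, so the product of
  the two matrices is given by a convolution on the group.
\<close>

lemma sum_sign_products: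
  assumes "i < Coset.order G" "j < Coset.order G"
  shows "(\<Sum>l<Coset.order G. sign (e i \<otimes> inv (e l)) * sign (e l \<otimes> inv (e j)))
    = signed_count (e i \<otimes> inv (e j))"
proof -
  have ij: "e i \<in> carrier G" "e j \<in> carrier G" using assms enum_in_carrier by auto
  have "(\<Sum>l<Coset.order G. sign (e i \<otimes> inv (e l)) * sign (e l \<otimes> inv (e j)))
      = (\<Sum>h\<in>carrier G. sign (e i \<otimes> inv h) * sign (h \<otimes> inv (e j)))"
    by (rule sum_enum)
  also have "\<dots> = (\<Sum>h\<in>carrier G. sign (e i \<otimes> inv h) * sign (inv (e i \<otimes> inv h) \<otimes> (e i \<otimes> inv (e j))))"
    using ij by (intro sum.cong refl) (simp add: inv_mult_group m_assoc mult_inv_cancel)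
  also have "\<dots> = (\<Sum>a\<in>carrier G. sign a * sign (inv a \<otimes> (e i \<otimes> inv (e j))))"
    by (rule sum_right_divide[OF ij(1)])
  also have "\<dots> = signed_count (e i \<otimes> inv (e j))"
    using ij by (intro signed_count_convolution) simp
  finally show ?thesis .
qed

text \<open>
  The corner entry of the square is the order of \<open>G\<close> for any signs. The border entries are row and
  column sums of the inner block, all equal to \<open>|S| - |T|\<close>, and must equal \<open>\<nu>\<close> times the border entry 1.
  In the inner block the border adds 1 to the convolution.
\<close>

lemma bordered_satisfies_quadratic_iff:
  "satisfies_quadratic (Suc (Coset.order G)) (of_nat (Coset.order G)) (of_real \<nu>) bordered \<longleftrightarrow>
    \<nu> = of_int (int (card S) - int (card T)) \<and>
    (\<forall>x\<in>carrier G. 1 + signed_count x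
       = (if x = \<one> then int (Coset.order G) else 0) + (int (card S) - int (card T)) * sign x)"
proof -
  let ?m = "Coset.order G" and ?\<mu> = "int (card S) - int (card T)"
  have m: "?m > 0" using finite_carrier order_gt_0_iff_finite by blast
  have row: "(\<Sum>l<?m. of_int (sign (e l \<otimes> inv (e j)))) = (of_int ?\<mu> :: complex)"
    and col: "(\<Sum>l<?m. of_int (sign (e j \<otimes> inv (e l)))) = (of_int ?\<mu> :: complex)"
    if "j < ?m" for j
    using sum_sign_rows[OF that] by (simp_all flip: of_int_sum)
  have prods: "(\<Sum>l<?m. of_int (sign (e i \<otimes> inv (e l))) * of_int (sign (e l \<otimes> inv (e j))))
      = (of_int (signed_count (e i \<otimes> inv (e j))) :: complex)" if "i < ?m" "j < ?m" for i j
    using sum_sign_products[OF that] by (simp flip: of_int_sum of_int_mult)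
  have "(\<Sum>l<Suc ?m. bordered $$ (0, l) * bordered $$ (l, 0)) = of_nat ?m"
    by (simp add: sum.lessThan_Suc_shift bordered_entries del: sum.lessThan_Suc)
  moreover have "(\<Sum>l<Suc ?m. bordered $$ (0, l) * bordered $$ (l, Suc j)) = of_int ?\<mu>"
    if "j < ?m" for j
    using row[OF that] that
    by (simp add: sum.lessThan_Suc_shift bordered_entries del: sum.lessThan_Suc)
  moreover have "(\<Sum>l<Suc ?m. bordered $$ (Suc i, l) * bordered $$ (l, 0)) = of_int ?\<mu>"
    if "i < ?m" for i
    using col[OF that] that
    by (simp add: sum.lessThan_Suc_shift bordered_entries del: sum.lessThan_Suc)
  moreover have "(\<Sum>l<Suc ?m. bordered $$ (Suc i, l) * bordered $$ (l, Suc j))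
      = 1 + of_int (signed_count (e i \<otimes> inv (e j)))"
    if "i < ?m" "j < ?m" for i j
    using prods[OF that] that
    by (simp add: sum.lessThan_Suc_shift bordered_entries del: sum.lessThan_Suc)
  ultimately have "satisfies_quadratic (Suc ?m) (of_nat ?m) (of_real \<nu>) bordered \<longleftrightarrow>
      (\<forall>j<?m. of_int ?\<mu> = complex_of_real \<nu>) \<and>
      (\<forall>i<?m. of_int ?\<mu> = complex_of_real \<nu> \<and>
        (\<forall>j<?m. 1 + of_int (signed_count (e i \<otimes> inv (e j)))
           = (if i = j then of_nat ?m else 0)
             + complex_of_real \<nu> * of_int (sign (e i \<otimes> inv (e j)))))"
    by (simp add: satisfies_quadratic_def All_less_Suc2 bordered_entries
        del: sum.lessThan_Suc of_int_diff)
  also have "\<dots> \<longleftrightarrow> of_int ?\<mu> = complex_of_real \<nu> \<and>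
      (\<forall>i<?m. \<forall>j<?m. 1 + of_int (signed_count (e i \<otimes> inv (e j)))
         = (if i = j then of_nat ?m else 0)
           + complex_of_real \<nu> * of_int (sign (e i \<otimes> inv (e j))))"
    using m by blast
  also have "\<dots> \<longleftrightarrow> \<nu> = of_int ?\<mu> \<and>
      (\<forall>i<?m. \<forall>j<?m. 1 + of_int (signed_count (e i \<otimes> inv (e j)))
         = (if i = j then of_nat ?m else 0)
           + complex_of_int ?\<mu> * of_int (sign (e i \<otimes> inv (e j))))"
  proof -
    have "of_int ?\<mu> = complex_of_real \<nu> \<longleftrightarrow> \<nu> = of_int ?\<mu>"
      by (metis of_real_eq_iff of_real_of_int_eq)
    then show ?thesis by (simp cong: conj_cong)
  qed
  also have "\<dots> \<longleftrightarrow> \<nu> = of_int ?\<mu> \<and>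
      (\<forall>i<?m. \<forall>j<?m. 1 + signed_count (e i \<otimes> inv (e j))
         = (if e i \<otimes> inv (e j) = \<one> then int ?m else 0) + ?\<mu> * sign (e i \<otimes> inv (e j)))"
  proof -
    have "1 + complex_of_int a = (if b then of_nat ?m else 0) + of_int ?\<mu> * of_int c \<longleftrightarrow>
        1 + a = (if b then int ?m else 0) + ?\<mu> * c" for a b c
    proof -
      have "1 + complex_of_int a = of_int (1 + a)"
        and "(if b then of_nat ?m else 0) + of_int ?\<mu> * of_int c
          = complex_of_int ((if b then int ?m else 0) + ?\<mu> * c)" by simp_all
      then show ?thesis by (simp only: of_int_eq_iff)
    qed
    then show ?thesis by (simp only: quotient_eq_one_iff cong: conj_cong imp_cong)
  qed
  also have "(\<forall>i<?m. \<forall>j<?m. 1 + signed_count (e i \<otimes> inv (e j))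
         = (if e i \<otimes> inv (e j) = \<one> then int ?m else 0) + ?\<mu> * sign (e i \<otimes> inv (e j))) \<longleftrightarrow>
      (\<forall>x\<in>carrier G. 1 + signed_count x = (if x = \<one> then int ?m else 0) + ?\<mu> * sign x)"
    by (rule all_quotients_iff)
  finally show ?thesis .
qed

text \<open>
  For symmetric signs the convolution at the identity is the sum of the squares of all signs, one for
  each element other than the identity.
\<close>

lemma signed_count_one:
  assumes "\<forall>x\<in>carrier G. sign (inv x) = sign x"
  shows "1 + signed_count \<one> = int (Coset.order G)"
proof -
  have "signed_count \<one> = (\<Sum>a\<in>carrier G. sign a * sign (inv a))"
    using signed_count_convolution[of \<one>] by simp
  also have "\<dots> = (\<Sum>a\<in>carrier G. if a = \<one> then 0 else 1)"
    using assms by (intro sum.cong refl) (auto elim!: sign_cases)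
  also have "\<dots> = int (card (carrier G - {\<one>}))"
    using finite_carrier by (simp add: sum.If_cases Diff_eq)
  also have "\<dots> = int (Coset.order G) - 1"
    using finite_carrier order_gt_0_iff_finite by (simp add: Coset.order_def of_nat_diff)
  finally show ?thesis by simp
qed

lemma signed_count_conditions_iff:
  assumes "\<forall>x\<in>carrier G. sign (inv x) = sign x"
  shows "(\<forall>x\<in>carrier G. 1 + signed_count x
       = (if x = \<one> then int (Coset.order G) else 0) + \<mu> * sign x) \<longleftrightarrow>
    (\<forall>g\<in>S. signed_count g = \<mu> - 1) \<and> (\<forall>h\<in>T. signed_count h = - \<mu> - 1)"
proof -
  have "\<forall>x\<in>S \<union> T. x \<noteq> \<one>" using partition(4,5) by auto
  then show ?thesis
    using signed_count_one[OF assms]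
    by (subst partition(6)) (auto simp: ball_Un sign_values)
qed

end


section \<open>The characterization of quasi-signature sets\<close>

theorem theorem5p2:
  fixes G :: "('a, 'b) monoid_scheme" and e :: "nat \<Rightarrow> 'a"
    and S T :: "'a set" and m n :: nat and \<mu> :: int
  assumes "group G" and "finite (carrier G)" and "m = Coset.order G"
    and "bij_betw e {..<m} (carrier G)"
    and "S \<subseteq> carrier G - {\<one>\<^bsub>G\<^esub>}"
    and "T = (carrier G - {\<one>\<^bsub>G\<^esub>}) - S"
    and "n = m + 1"
    and "\<mu> = int (card S) - int (card T)"
  shows
    "((\<exists>k. quasi_signature_set G e n k S) \<longleftrightarrow>
       ((\<forall>g\<in>S. inv\<^bsub>G\<^esub> g \<in> S) \<and> (\<forall>h\<in>T. inv\<^bsub>G\<^esub> h \<in> T)) \<and>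
       ((\<forall>g\<in>S. int (num_factorizations G S S g) - 2 * int (num_factorizations G S T g)
                + int (num_factorizations G T T g) = \<mu> - 1) \<and>
        (\<forall>h\<in>T. int (num_factorizations G S S h) - 2 * int (num_factorizations G S T h)
                + int (num_factorizations G T T h) = - \<mu> - 1))) \<and>
     (\<forall>k. quasi_signature_set G e n k S \<longrightarrow>
        real_of_int \<mu> =
          (real n - 2 * real k) * sqrt ((real n - 1) / (real k * (real n - real k))) \<and>
        real k =
          real n / 2 - real_of_int \<mu> * real n / (2 * sqrt (4 * (real n - 1) + (real_of_int \<mu>)\<^sup>2)))"
proof -
  interpret group G by fact
  interpret signed_partition G e S T
    using assms by unfold_locales auto
  have n: "n = Suc (Coset.order G)" using assms by simp
  have m: "Coset.order G > 0" using finite_carrier order_gt_0_iff_finite by blast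
  have quasi: "quasi_signature_set G e n k S \<longleftrightarrow> signature_matrix n k bordered" for k
    using assms(5) by (simp add: quasi_signature_set_def bordered_def n flip: T_eq)
  have quad: "satisfies_quadratic n (of_real (real n - 1)) (of_real \<nu>) bordered \<longleftrightarrow>
      \<nu> = of_int \<mu> \<and> (\<forall>x\<in>carrier G. 1 + signed_count x
        = (if x = \<one>\<^bsub>G\<^esub> then int (Coset.order G) else 0) + \<mu> * sign x)" for \<nu>
    using bordered_satisfies_quadratic_iff[of \<nu>] assms(8) by (simp add: n)
  have forward: "((\<forall>g\<in>S. inv\<^bsub>G\<^esub> g \<in> S) \<and> (\<forall>h\<in>T. inv\<^bsub>G\<^esub> h \<in> T)) \<and>
      ((\<forall>g\<in>S. signed_count g = \<mu> - 1) \<and> (\<forall>h\<in>T. signed_count h = - \<mu> - 1)) \<and>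
      of_int \<mu> = frame_eigenvalue_sum n k \<and> 1 \<le> k \<and> k < n"
    if sig: "signature_matrix n k bordered" for k
  proof -
    have "mat_adjoint bordered = bordered" and k: "1 \<le> k" "k < n"
      using sig by (auto simp: signature_matrix_def)
    then have sym: "(\<forall>g\<in>S. inv\<^bsub>G\<^esub> g \<in> S) \<and> (\<forall>h\<in>T. inv\<^bsub>G\<^esub> h \<in> T)"
      by (simp only: bordered_self_adjoint_iff)
    then show ?thesis
      using signature_matrix_satisfies_quadratic[OF sig] k sign_inv_iff
        signed_count_conditions_iff[of \<mu>]
      unfolding quad by simp
  qed
  have backward: "\<exists>k. signature_matrix n k bordered"
    if sym: "(\<forall>g\<in>S. inv\<^bsub>G\<^esub> g \<in> S) \<and> (\<forall>h\<in>T. inv\<^bsub>G\<^esub> h \<in> T)"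
      and count: "(\<forall>g\<in>S. signed_count g = \<mu> - 1) \<and> (\<forall>h\<in>T. signed_count h = - \<mu> - 1)"
  proof (rule satisfies_quadratic_imp_signature_matrix)
    show "n \<ge> 2" using n m by simp
    show "mat_adjoint bordered = bordered" using sym by (simp only: bordered_self_adjoint_iff)
    show "satisfies_quadratic n (of_real (real n - 1)) (of_real (of_int \<mu>)) bordered"
      unfolding quad using sym count sign_inv_iff signed_count_conditions_iff[of \<mu>] by simp
  qed (use n bordered_carrier bordered_zero_diagonal bordered_unimodular in simp_all)
  have formulas: "real_of_int \<mu> =
          (real n - 2 * real k) * sqrt ((real n - 1) / (real k * (real n - real k))) \<and>
        real k =
          real n / 2 - real_of_int \<mu> * real n / (2 * sqrt (4 * (real n - 1) + (real_of_int \<mu>)\<^sup>2))"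
    if sig: "signature_matrix n k bordered" for k
  proof
    have \<mu>: "of_int \<mu> = frame_eigenvalue_sum n k" and k: "1 \<le> k" "k < n"
      using forward[OF sig] by simp_all
    show "real_of_int \<mu>
        = (real n - 2 * real k) * sqrt ((real n - 1) / (real k * (real n - real k)))"
      using \<mu> by (simp only: frame_eigenvalue_sum_def)
    show "real k =
        real n / 2 - real_of_int \<mu> * real n / (2 * sqrt (4 * (real n - 1) + (real_of_int \<mu>)\<^sup>2))"
      by (rule frame_dimension_from_eigenvalue_sum[OF k \<mu>])
  qed
  show ?thesis
    unfolding quasi using forward backward formulas unfolding signed_count_def by blast
qed

end
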